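(* Let $b>1$ be an integer and let $\alpha\in\{0,\dots,b-1\}$. Let $K_0$ be the sum of the $1/n$'s over all integers $n>0$ having no $\alpha\alpha$ sub-string in their minimal representation with base-$b$ digits. Then $$ \begin{aligned} K_0 ={}& \sum_{n_1=1}^{b-1}\frac1{n_1} + b^2 \Biggl( \sum_{\substack{1\leq n_1<b\\ 0\leq n_2<b\\ (n_1,n_2)\neq(\alpha,\alpha)}} \frac1{n_1b+n_2} +\sum_{\substack{1\leq n_1<b\\ 0\leq n_2<b\\ n_2\neq\alpha}} \frac{1}{n_1b^2+n_2b+\alpha} \Biggr)\\ &+\sum_{m=1}^\infty (-1)^m u_m \Biggl( \sum_{\substack{1\leq n_1<b\\ 0\leq n_2<b\\ (n_1,n_2)\neq(\alpha,\alpha)}} \frac1{(n_1b+n_2)^{m+1}} +\sum_{\substack{1\leq n_1<b\\ 0\leq n_2<b\\ n_2\neq\alpha}} \frac{1}{(n_1b^2+n_2b+\alpha)^{m+1}} \Biggr), \end{aligned} $$ where $(u_m)_{m\ge0}$ is a positive sequence decreasing to zero and verifying $u_0=b^2$ and, for all $m\ge1$, the recurrence $$ \bigl(b^{m+1} - (b-1) - (b-1)b^{-m-1}\bigr)u_m = \sum_{j=1}^m\binom{m}{j}\bigl(\gamma_j'+b^{-m-1}\theta_j'\bigr)u_{m-j}, $$ with $$ \gamma_j' = \sum_{\substack{0\leq d<b\\ d\neq\alpha}} d^j,\qquad \theta_j' = \sum_{\substack{0\leq d<b\\ d\neq\alpha}} (db+\alpha)^j . $$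
   Context: The minimal base-$b$ representation of a positive integer is the one without leading zeroes. A sub-string $\alpha\alpha$ means the digit $\alpha$ appearing at two consecutive positions. *)

theory Defs
  imports "HOL-Analysis.Analysis" "HOL-Library.Sublist"
begin

text \<open>
  Digits are listed with the most significant one first, and \<open>0\<close> is represented by the empty list.
  The guard \<open>b \<le> 1\<close> only serves termination.
\<close>

function base_digits :: "nat \<Rightarrow> nat \<Rightarrow> nat list" where
  "base_digits b n = (if b \<le> 1 \<or> n = 0 then [] else base_digits b (n div b) @ [n mod b])"
  by auto
termination
  by (relation "Wellfounded.measure snd") auto

declare base_digits.simps [simp del]

lemma base_digits_0 [simp]: "base_digits b 0 = []"
  by (simp add: base_digits.simps)

lemma base_digits_rec:
  assumes "b > 1" "n > 0"
  shows "base_digits b n = base_digits b (n div b) @ [n mod b]"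
  using assms by (subst base_digits.simps) simp

text \<open>
  For \<open>b > 1\<close>, the list \<open>base_digits b n\<close> is the unique list of base-\<open>b\<close> digits without leading
  zeroes whose value is \<open>n\<close>.
\<close>

lemma base_digits_unique:
  assumes "b > 1"
  shows "ds = base_digits b n \<longleftrightarrow>
    (\<forall>d\<in>set ds. d < b) \<and> (ds \<noteq> [] \<longrightarrow> hd ds \<noteq> 0) \<and> horner_sum (\<lambda>d. d) b (rev ds) = n"
proof (induction ds arbitrary: n rule: rev_induct)
  case Nil
  show ?case
    using assms by (cases "n = 0") (auto simp: base_digits_rec)
next
  case (snoc d ds)
  show ?case
  proof (cases "n = 0")
    case True
    have "\<not> (ds @ [d] \<noteq> [] \<longrightarrow> hd (ds @ [d]) \<noteq> 0) \<or> horner_sum (\<lambda>d. d) b (rev (ds @ [d])) \<noteq> 0"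
      if "\<forall>d\<in>set ds. d < b"
    proof (cases "ds = []")
      case False
      have "horner_sum (\<lambda>d. d) b (rev ds) \<noteq> 0" if "hd ds \<noteq> 0"
        using snoc.IH[of 0] \<open>\<forall>d\<in>set ds. d < b\<close> that False by auto
      then show ?thesis
        using False assms by auto
    qed auto
    with True show ?thesis by auto
  next
    case False
    have eq: "d + b * v = n \<longleftrightarrow> v = n div b \<and> d = n mod b" if "d < b" for v
      using that assms by auto
    have nz: "n mod b \<noteq> 0" if "n div b = 0"
      using that False assms by (auto simp: div_eq_0_iff)
    have "ds @ [d] = base_digits b n \<longleftrightarrow> ds = base_digits b (n div b) \<and> d = n mod b"
      using base_digits_rec[OF assms, of n] False by simp
    also have "\<dots> \<longleftrightarrow> (\<forall>d\<in>set ds. d < b) \<and> (ds \<noteq> [] \<longrightarrow> hd ds \<noteq> 0) \<and>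
        horner_sum (\<lambda>d. d) b (rev ds) = n div b \<and> d = n mod b"
      using snoc.IH[of "n div b"] by blast
    also have "\<dots> \<longleftrightarrow> (\<forall>d\<in>set (ds @ [d]). d < b) \<and> (ds @ [d] \<noteq> [] \<longrightarrow> hd (ds @ [d]) \<noteq> 0) \<and>
        horner_sum (\<lambda>d. d) b (rev (ds @ [d])) = n"
      using eq[of "horner_sum (\<lambda>d. d) b (rev ds)"] nz assms mod_less_divisor[of b n]
      by (cases "ds = []") (auto simp del: mod_less_divisor)
    finally show ?thesis .
  qed
qed

definition no_double :: "nat \<Rightarrow> nat \<Rightarrow> nat set" where
  "no_double b \<alpha> = {n. n > 0 \<and> \<not> sublist [\<alpha>, \<alpha>] (base_digits b n)}"

definition K0 :: "nat \<Rightarrow> nat \<Rightarrow> real" where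
  "K0 b \<alpha> = (\<Sum>\<^sub>\<infinity>n\<in>no_double b \<alpha>. 1 / real n)"

definition block_sum :: "nat \<Rightarrow> nat \<Rightarrow> nat \<Rightarrow> real" where
  "block_sum b \<alpha> k =
     (\<Sum>(n1, n2) | 1 \<le> n1 \<and> n1 < b \<and> n2 < b \<and> (n1, n2) \<noteq> (\<alpha>, \<alpha>).
        1 / real (n1 * b + n2) ^ k) +
     (\<Sum>(n1, n2) | 1 \<le> n1 \<and> n1 < b \<and> n2 < b \<and> n2 \<noteq> \<alpha>.
        1 / real (n1 * b\<^sup>2 + n2 * b + \<alpha>) ^ k)"

definition gamma' :: "nat \<Rightarrow> nat \<Rightarrow> nat \<Rightarrow> real" where
  "gamma' b \<alpha> j = (\<Sum>d | d < b \<and> d \<noteq> \<alpha>. real d ^ j)"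

definition theta' :: "nat \<Rightarrow> nat \<Rightarrow> nat \<Rightarrow> real" where
  "theta' b \<alpha> j = (\<Sum>d | d < b \<and> d \<noteq> \<alpha>. real (d * b + \<alpha>) ^ j)"

end

theory Submission
  imports Defs
begin

text \<open>
  The series comes from cutting off the first two or three digits of an integer and expanding the
  reciprocal around them. Let \<open>T\<close> be the set of digit words, leading zeroes and the empty word
  included, that contain no \<open>\<alpha>\<alpha>\<close> and do not begin with \<open>\<alpha>\<close>; write \<open>x(w) \<in> [0, 1)\<close> for the number
  that \<open>w\<close> denotes when it is read after the radix point. In an integer \<open>n1 n2 v\<close> without \<open>\<alpha>\<alpha>\<close>,
  either \<open>v\<close> lies in \<open>T\<close> and the only constraint on the digits before it is \<open>(n1, n2) \<noteq> (\<alpha>, \<alpha>)\<close>,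
  or \<open>v = \<alpha>w\<close> with \<open>w\<close> in \<open>T\<close>, and then the constraint is \<open>n2 \<noteq> \<alpha>\<close> (lemma
  \<open>admissible_numerals_unfold\<close>). So every integer with at least two digits is, in exactly one way,
  a block of value \<open>N\<close> from one of the two families in the formula, followed by a word \<open>w\<close> from
  \<open>T\<close>, and its reciprocal is \<open>b^(-|w|) / (N + x(w))\<close>.

  Hence the reciprocals that belong to one block add up to the integral of \<open>1 / (N + x)\<close> against
  the discrete measure that puts mass \<open>b^(-|w|)\<close> at \<open>x(w)\<close> for each \<open>w\<close> in \<open>T\<close>. Let \<open>u m\<close> be the \<open>m\<close>-th moment of this
  measure. The finite geometric expansion of \<open>1 / (N + x)\<close> in powers of \<open>-x / N\<close> has a remainder
  that is at most \<open>x^M\<close>; integrated, it is at most \<open>u M\<close>. As the moments tend to zero, the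
  alternating series converges to the integral (lemma \<open>continuation_sum_sums\<close>). Working with this
  remainder avoids any exchange of two infinite sums.

  The recurrence expresses that \<open>T\<close> is self-similar: a nonempty word of \<open>T\<close> is uniquely \<open>dw\<close> or
  \<open>d\<alpha>w\<close> with a digit \<open>d \<noteq> \<alpha>\<close> and \<open>w\<close> in \<open>T\<close> (lemma \<open>tails_unfold\<close>). These two operations act on
  \<open>x\<close> by the affine maps \<open>(d + x) / b\<close> and \<open>(d b + \<alpha> + x) / b^2\<close> and on the mass by the factors
  \<open>1 / b\<close> and \<open>1 / b^2\<close>; the binomial theorem turns this into a linear relation among the moments.
  For \<open>m = 0\<close> it determines the total mass \<open>b^2\<close>, once that mass is known to be finite. Finiteness
  is obtained from the same relation, applied as an inequality to the words of bounded length
  (lemma \<open>sum_weight_short_tails_le\<close>).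
\<close>

section \<open>Finite decompositions of unconditional sums\<close>

lemma has_sum_sum:
  fixes f :: "'i \<Rightarrow> 'a \<Rightarrow> 'b :: topological_comm_monoid_add"
  assumes "finite I" and "\<And>i. i \<in> I \<Longrightarrow> (f i has_sum s i) A"
  shows "((\<lambda>x. \<Sum>i\<in>I. f i x) has_sum sum s I) A"
  using assms by (induction I) (auto intro: has_sum_add)

text \<open>
  All prefixes have the same length, so the sets of words that begin with different prefixes are
  disjoint, and a sum over words splits according to the prefix.
\<close>

lemma has_sum_prefixed:
  fixes g :: "nat list \<Rightarrow> real"
  assumes "finite I" and "inj_on pre I" and len: "\<And>i. i \<in> I \<Longrightarrow> length (pre i) = k"
    and "\<And>i. i \<in> I \<Longrightarrow> ((\<lambda>w. g (pre i @ w)) has_sum s i) W"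
  shows "(g has_sum sum s I) (\<Union>i\<in>I. (@) (pre i) ` W)"
proof (rule sum_has_sum)
  show "(g has_sum s i) ((@) (pre i) ` W)" if "i \<in> I" for i
    using assms(4)[OF that] by (subst has_sum_reindex) (auto simp: inj_on_def o_def)
  show "(@) (pre i) ` W \<inter> (@) (pre j) ` W = {}" if "i \<in> I" "j \<in> I" "i \<noteq> j" for i j
    using that inj_onD[OF assms(2), of i j] len[of i] len[of j] by auto
qed fact

section \<open>Digit strings read after the radix point\<close>

fun base_frac :: "nat \<Rightarrow> nat list \<Rightarrow> real" where
  "base_frac b [] = 0"
| "base_frac b (d # w) = (real d + base_frac b w) / real b"

lemma base_frac_nonneg: "base_frac b w \<ge> 0"
  by (induction w) auto

lemma base_frac_less_1:
  assumes "set w \<subseteq> {..<b}"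
  shows "base_frac b w < 1"
  using assms
proof (induction w)
  case (Cons d w)
  then have "base_frac b w < 1" and "real d + 1 \<le> real b"
    by auto
  then have "real d + base_frac b w < real b"
    by linarith
  then show ?case
    by (simp add: divide_simps)
qed simp

lemma digits_value_eq_frac:
  assumes "b > 0"
  shows "real (horner_sum (\<lambda>d. d) b (rev w)) = real b ^ length w * base_frac b w"
proof (induction w)
  case (Cons d w)
  then show ?case
    using assms by (simp add: horner_sum_append field_simps)
qed simp

lemma sublist_double_Cons:
  "sublist [\<alpha>, \<alpha>] (d # w) \<longleftrightarrow> d = \<alpha> \<and> w \<noteq> [] \<and> hd w = \<alpha> \<or> sublist [\<alpha>, \<alpha>] w"
  by (cases w) (auto simp: sublist_Cons_right)

section \<open>The self-similar set of continuations\<close>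

text \<open>
  The condition on the head makes any digit, \<open>\<alpha>\<close> included, a legitimate digit to put in front of
  such a word. The words that do begin with \<open>\<alpha>\<close> are recovered by prepending that \<open>\<alpha>\<close>.
\<close>

definition tails :: "nat \<Rightarrow> nat \<Rightarrow> nat list set" where
  "tails b \<alpha> = {w. set w \<subseteq> {..<b} \<and> \<not> sublist [\<alpha>, \<alpha>] w \<and> (w \<noteq> [] \<longrightarrow> hd w \<noteq> \<alpha>)}"

abbreviation other_digits :: "nat \<Rightarrow> nat \<Rightarrow> nat set" where
  "other_digits b \<alpha> \<equiv> {d. d < b \<and> d \<noteq> \<alpha>}"

lemma card_other_digits: "\<alpha> < b \<Longrightarrow> card (other_digits b \<alpha>) = b - 1"
proof -
  assume "\<alpha> < b"
  moreover have "other_digits b \<alpha> = {..<b} - {\<alpha>}" by auto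
  ultimately show ?thesis by simp
qed

lemma no_double_split:
  assumes "\<alpha> < b"
  shows "{w. set w \<subseteq> {..<b} \<and> \<not> sublist [\<alpha>, \<alpha>] w} = tails b \<alpha> \<union> (#) \<alpha> ` tails b \<alpha>"
proof (rule set_eqI)
  fix w
  show "w \<in> {w. set w \<subseteq> {..<b} \<and> \<not> sublist [\<alpha>, \<alpha>] w} \<longleftrightarrow> w \<in> tails b \<alpha> \<union> (#) \<alpha> ` tails b \<alpha>"
    using assms by (cases w) (auto simp: tails_def sublist_double_Cons)
qed

lemma tails_unfold:
  assumes "\<alpha> < b"
  shows "tails b \<alpha> = insert [] ((\<Union>d\<in>other_digits b \<alpha>. (@) [d] ` tails b \<alpha>) \<union>
                               (\<Union>d\<in>other_digits b \<alpha>. (@) [d, \<alpha>] ` tails b \<alpha>))"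
proof (rule set_eqI)
  fix w
  show "w \<in> tails b \<alpha> \<longleftrightarrow> w \<in> insert [] ((\<Union>d\<in>other_digits b \<alpha>. (@) [d] ` tails b \<alpha>) \<union>
                               (\<Union>d\<in>other_digits b \<alpha>. (@) [d, \<alpha>] ` tails b \<alpha>))"
  proof (cases w)
    case Nil
    then show ?thesis by (simp add: tails_def)
  next
    case (Cons d v)
    have "d # v \<in> tails b \<alpha> \<longleftrightarrow> d \<in> other_digits b \<alpha> \<and> v \<in> {w. set w \<subseteq> {..<b} \<and> \<not> sublist [\<alpha>, \<alpha>] w}"
      by (auto simp: tails_def sublist_double_Cons)
    then show ?thesis
      unfolding no_double_split[OF assms] Cons by auto
  qed
qed

text \<open>
  Integration against the self-similarity of \<open>tails b \<alpha>\<close>: the empty word, the words \<open>d # w\<close>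
  and the words \<open>d # \<alpha> # w\<close> contribute separately.
\<close>

lemma tails_has_sum:
  fixes g :: "nat list \<Rightarrow> real"
  assumes "\<alpha> < b"
    and "\<And>d. d \<in> other_digits b \<alpha> \<Longrightarrow> ((\<lambda>w. g (d # w)) has_sum s d) (tails b \<alpha>)"
    and "\<And>d. d \<in> other_digits b \<alpha> \<Longrightarrow> ((\<lambda>w. g (d # \<alpha> # w)) has_sum t d) (tails b \<alpha>)"
  shows "(g has_sum (g [] + (sum s (other_digits b \<alpha>) + sum t (other_digits b \<alpha>)))) (tails b \<alpha>)"
proof -
  let ?D = "other_digits b \<alpha>" and ?T = "tails b \<alpha>"
  have "(g has_sum sum s ?D) (\<Union>d\<in>?D. (@) [d] ` ?T)"
    by (rule has_sum_prefixed[where k = 1]) (use assms(2) in \<open>auto simp: inj_on_def\<close>)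
  moreover have "(g has_sum sum t ?D) (\<Union>d\<in>?D. (@) [d, \<alpha>] ` ?T)"
    by (rule has_sum_prefixed[where k = 2]) (use assms(3) in \<open>auto simp: inj_on_def\<close>)
  moreover have "(\<Union>d\<in>?D. (@) [d] ` ?T) \<inter> (\<Union>d\<in>?D. (@) [d, \<alpha>] ` ?T) = {}"
    by (auto simp: tails_def)
  ultimately have "(g has_sum (sum s ?D + sum t ?D))
      ((\<Union>d\<in>?D. (@) [d] ` ?T) \<union> (\<Union>d\<in>?D. (@) [d, \<alpha>] ` ?T))"
    by (rule has_sum_Un_disjoint)
  then show ?thesis
    by (subst tails_unfold[OF assms(1)], intro has_sum_insert) auto
qed

section \<open>Total mass\<close>

abbreviation weight :: "nat \<Rightarrow> nat list \<Rightarrow> real" where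
  "weight b w \<equiv> 1 / real b ^ length w"

text \<open>
  The bound \<open>b\<^sup>2\<close> is the fixed point of the relation \<open>t = 1 + (b - 1) / b * t + (b - 1) / b\<^sup>2 * t\<close>
  that self-similarity imposes on the total mass. Removing a prefix shortens a word, so induction on
  the length preserves the bound.
\<close>

lemma sum_weight_short_tails_le:
  assumes "b > 1" and "\<alpha> < b"
  shows "(\<Sum>w | w \<in> tails b \<alpha> \<and> length w \<le> L. weight b w) \<le> real b ^ 2"
proof (induction L)
  case 0
  have "{w. w \<in> tails b \<alpha> \<and> length w \<le> 0} = {[]}"
    by (auto simp: tails_def)
  then show ?case
    using assms by simp
next
  case (Suc L)
  let ?D = "other_digits b \<alpha>"
  let ?T = "\<lambda>L. {w. w \<in> tails b \<alpha> \<and> length w \<le> L}"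
  let ?A = "(\<lambda>(d, w). d # w) ` (?D \<times> ?T L)" and ?B = "(\<lambda>(d, w). d # \<alpha> # w) ` (?D \<times> ?T L)"
  have finT: "finite (?T L)" for L
    by (rule finite_subset[OF _ finite_lists_length_le[of "{..<b}" L]]) (auto simp: tails_def)
  have fin: "finite ?A" "finite ?B"
    using finT by auto
  have sub: "?T (Suc L) \<subseteq> insert [] (?A \<union> ?B)"
  proof
    fix w assume w: "w \<in> ?T (Suc L)"
    then have "w \<in> insert [] ((\<Union>d\<in>?D. (@) [d] ` tails b \<alpha>) \<union> (\<Union>d\<in>?D. (@) [d, \<alpha>] ` tails b \<alpha>))"
      using tails_unfold[OF assms(2)] by blast
    then show "w \<in> insert [] (?A \<union> ?B)"
      using w by force
  qed
  have count: "(\<Sum>(d, w)\<in>?D \<times> ?T L. weight b w / c) = (real b - 1) / c * (\<Sum>w\<in>?T L. weight b w)"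
    for c :: real
    using assms
    by (simp add: sum.cartesian_product[symmetric] card_other_digits of_nat_diff
        sum_divide_distrib[symmetric] del: divide_divide_eq_left)
  have A: "(\<Sum>w\<in>?A. weight b w) = (real b - 1) / real b * (\<Sum>w\<in>?T L. weight b w)"
    unfolding count[symmetric]
    by (subst sum.reindex) (auto simp: inj_on_def case_prod_unfold mult.commute)
  have B: "(\<Sum>w\<in>?B. weight b w) = (real b - 1) / real b ^ 2 * (\<Sum>w\<in>?T L. weight b w)"
    unfolding count[symmetric]
    by (subst sum.reindex) (auto simp: inj_on_def case_prod_unfold power2_eq_square mult_ac)
  have "(\<Sum>w\<in>?T (Suc L). weight b w) \<le> (\<Sum>w\<in>insert [] (?A \<union> ?B). weight b w)"
    by (intro sum_mono2 sub) (use fin in auto)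
  also have "\<dots> \<le> 1 + ((\<Sum>w\<in>?A. weight b w) + (\<Sum>w\<in>?B. weight b w))"
    using fin by (subst sum.insert) (auto simp: sum_Un sum_nonneg)
  also have "\<dots> \<le> 1 + ((real b - 1) / real b * real b ^ 2 + (real b - 1) / real b ^ 2 * real b ^ 2)"
    unfolding A B using Suc.IH assms by (intro add_mono mult_left_mono) auto
  also have "\<dots> = real b ^ 2"
    using assms by (simp add: field_simps power2_eq_square)
  finally show ?case .
qed

lemma weight_summable:
  assumes "b > 1" and "\<alpha> < b"
  shows "weight b summable_on tails b \<alpha>"
proof (rule nonneg_bdd_above_summable_on)
  show "bdd_above (sum (weight b) ` {F. F \<subseteq> tails b \<alpha> \<and> finite F})"
  proof (rule bdd_aboveI2)
    fix F assume "F \<in> {F. F \<subseteq> tails b \<alpha> \<and> finite F}"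
    then have F: "F \<subseteq> tails b \<alpha>" "finite F" by auto
    define L where "L = Max (insert 0 (length ` F))"
    have L: "length w \<le> L" if "w \<in> F" for w
      using F(2) that by (auto simp: L_def)
    have "sum (weight b) F \<le> (\<Sum>w | w \<in> tails b \<alpha> \<and> length w \<le> L. weight b w)"
    proof (rule sum_mono2)
      show "finite {w. w \<in> tails b \<alpha> \<and> length w \<le> L}"
        by (rule finite_subset[OF _ finite_lists_length_le[of "{..<b}" L]]) (auto simp: tails_def)
    qed (use F L in auto)
    then show "sum (weight b) F \<le> real b ^ 2"
      using sum_weight_short_tails_le[OF assms] by (rule order_trans)
  qed
qed auto

section \<open>Moments\<close>

definition moment :: "nat \<Rightarrow> nat \<Rightarrow> nat \<Rightarrow> real" where
  "moment b \<alpha> m = (\<Sum>\<^sub>\<infinity>w\<in>tails b \<alpha>. weight b w * base_frac b w ^ m)"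

lemma tails_frac_less_1: "w \<in> tails b \<alpha> \<Longrightarrow> base_frac b w < 1"
  by (rule base_frac_less_1) (auto simp: tails_def)

lemma moment_has_sum:
  assumes "b > 1" and "\<alpha> < b"
  shows "((\<lambda>w. weight b w * base_frac b w ^ m) has_sum moment b \<alpha> m) (tails b \<alpha>)"
proof -
  have "(\<lambda>w. weight b w * base_frac b w ^ m) summable_on tails b \<alpha>"
  proof (rule summable_on_comparison_test[OF weight_summable[OF assms]])
    fix w assume "w \<in> tails b \<alpha>"
    then have "base_frac b w ^ m \<le> 1"
      using tails_frac_less_1[of w b \<alpha>] base_frac_nonneg[of b w] by (intro power_le_one) auto
    then show "weight b w * base_frac b w ^ m \<le> weight b w"
      by (intro mult_left_le) auto
    show "0 \<le> weight b w * base_frac b w ^ m"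
      using base_frac_nonneg[of b w] by auto
  qed
  then show ?thesis
    unfolding moment_def by (rule has_sum_infsum)
qed

text \<open>
  Moments about the point \<open>-c\<close>: prepending digits to \<open>w\<close> adds an integer \<open>c\<close> to \<open>base_frac b w\<close>
  before rescaling.
\<close>

lemma moment_has_sum_shifted:
  assumes "b > 1" and "\<alpha> < b"
  shows "((\<lambda>w. weight b w * (c + base_frac b w) ^ m) has_sum
           (\<Sum>j\<le>m. real (m choose j) * c ^ j * moment b \<alpha> (m - j))) (tails b \<alpha>)"
proof -
  have "((\<lambda>w. \<Sum>j\<le>m. real (m choose j) * c ^ j * (weight b w * base_frac b w ^ (m - j))) has_sum
           (\<Sum>j\<le>m. real (m choose j) * c ^ j * moment b \<alpha> (m - j))) (tails b \<alpha>)"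
    by (intro has_sum_sum has_sum_cmult_right moment_has_sum assms) simp
  also have "(\<lambda>w. \<Sum>j\<le>m. real (m choose j) * c ^ j * (weight b w * base_frac b w ^ (m - j))) =
             (\<lambda>w. weight b w * (c + base_frac b w) ^ m)"
    by (rule ext) (simp add: binomial_ring sum_distrib_left mult_ac)
  finally show ?thesis .
qed

text \<open>
  The empty word, with mass 1 at zero, contributes \<open>0 ^ m\<close>. The index \<open>j = 0\<close> is kept on
  the right-hand side; collecting its terms with the left-hand side gives both the value of
  \<open>moment b \<alpha> 0\<close> and the recurrence.
\<close>

lemma moment_self_similar:
  assumes "b > 1" and "\<alpha> < b"
  shows "moment b \<alpha> m = 0 ^ m +
           (\<Sum>j\<le>m. real (m choose j) * (gamma' b \<alpha> j / real b ^ (m + 1) +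
              theta' b \<alpha> j / real b ^ (2 * (m + 1))) * moment b \<alpha> (m - j))"
proof -
  let ?D = "other_digits b \<alpha>"
  let ?g = "\<lambda>w. weight b w * base_frac b w ^ m"
  let ?S = "\<lambda>c. \<Sum>j\<le>m. real (m choose j) * c ^ j * moment b \<alpha> (m - j)"
  have "((\<lambda>w. ?g (d # w)) has_sum 1 / real b ^ (m + 1) * ?S (real d)) (tails b \<alpha>)" for d
  proof -
    have "(\<lambda>w. ?g (d # w)) = (\<lambda>w. 1 / real b ^ (m + 1) * (weight b w * (real d + base_frac b w) ^ m))"
      by (simp add: power_divide mult_ac)
    then show ?thesis
      by (simp only:) (rule has_sum_cmult_right[OF moment_has_sum_shifted[OF assms]])
  qed
  moreover have "((\<lambda>w. ?g (d # \<alpha> # w)) has_sum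
      1 / real b ^ (2 * (m + 1)) * ?S (real (d * b + \<alpha>))) (tails b \<alpha>)" for d
  proof -
    have "?g (d # \<alpha> # w) =
        1 / real b ^ (2 * (m + 1)) * (weight b w * (real (d * b + \<alpha>) + base_frac b w) ^ m)" for w
    proof -
      define y where "y = real (d * b + \<alpha>) + base_frac b w"
      define c where "c = real b ^ 2"
      have "base_frac b (d # \<alpha> # w) = y / c"
        using assms by (simp add: y_def c_def field_simps power2_eq_square)
      moreover have "weight b (d # \<alpha> # w) = 1 / c * weight b w"
        by (simp add: c_def power2_eq_square)
      ultimately have "?g (d # \<alpha> # w) = (1 / c * weight b w) * (y / c) ^ m"
        by (simp only:)
      also have "\<dots> = 1 / (c * c ^ m) * (weight b w * y ^ m)"
        by (simp add: power_divide mult_ac)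
      also have "c * c ^ m = real b ^ (2 * (m + 1))"
        unfolding c_def power_mult by simp
      finally have "?g (d # \<alpha> # w) = 1 / real b ^ (2 * (m + 1)) * (weight b w * y ^ m)" .
      then show ?thesis
        by (simp only: y_def)
    qed
    then show ?thesis
      by (simp only:) (rule has_sum_cmult_right[OF moment_has_sum_shifted[OF assms]])
  qed
  ultimately have "(?g has_sum (?g [] + ((\<Sum>d\<in>?D. 1 / real b ^ (m + 1) * ?S (real d)) +
      (\<Sum>d\<in>?D. 1 / real b ^ (2 * (m + 1)) * ?S (real (d * b + \<alpha>)))))) (tails b \<alpha>)"
    by (intro tails_has_sum assms)
  then have "moment b \<alpha> m = ?g [] + ((\<Sum>d\<in>?D. 1 / real b ^ (m + 1) * ?S (real d)) +
      (\<Sum>d\<in>?D. 1 / real b ^ (2 * (m + 1)) * ?S (real (d * b + \<alpha>))))"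
    using has_sum_unique moment_has_sum[OF assms] by blast
  also have "\<dots> = 0 ^ m + (\<Sum>j\<le>m. real (m choose j) * (gamma' b \<alpha> j / real b ^ (m + 1) +
              theta' b \<alpha> j / real b ^ (2 * (m + 1))) * moment b \<alpha> (m - j))"
  proof -
    have "(\<Sum>d\<in>?D. 1 / real b ^ k * ?S (h d)) =
        (\<Sum>j\<le>m. real (m choose j) * ((\<Sum>d\<in>?D. h d ^ j) / real b ^ k) * moment b \<alpha> (m - j))"
      for h :: "nat \<Rightarrow> real" and k
    proof -
      have "(\<Sum>d\<in>?D. 1 / real b ^ k * ?S (h d)) =
          (\<Sum>j\<le>m. \<Sum>d\<in>?D. 1 / real b ^ k * (real (m choose j) * h d ^ j * moment b \<alpha> (m - j)))"
        unfolding sum_distrib_left by (rule sum.swap)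
      also have "\<dots> = (\<Sum>j\<le>m. real (m choose j) * ((\<Sum>d\<in>?D. h d ^ j) / real b ^ k) * moment b \<alpha> (m - j))"
        by (intro sum.cong refl) (simp add: sum_distrib_left sum_distrib_right sum_divide_distrib mult_ac)
      finally show ?thesis .
    qed
    then show ?thesis
      unfolding gamma'_def theta'_def by (simp only: distrib_left distrib_right sum.distrib) simp
  qed
  finally show ?thesis .
qed

lemma gamma'_0: "\<alpha> < b \<Longrightarrow> gamma' b \<alpha> 0 = real b - 1"
  by (simp add: gamma'_def card_other_digits of_nat_diff)

lemma theta'_0: "\<alpha> < b \<Longrightarrow> theta' b \<alpha> 0 = real b - 1"
  by (simp add: theta'_def card_other_digits of_nat_diff)

lemma moment_0:
  assumes "b > 1" and "\<alpha> < b"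
  shows "moment b \<alpha> 0 = real b ^ 2"
proof -
  have "moment b \<alpha> 0 = 1 + ((real b - 1) / real b + (real b - 1) / real b ^ 2) * moment b \<alpha> 0"
    using moment_self_similar[OF assms, of 0] assms by (simp add: gamma'_0 theta'_0 power2_eq_square)
  then have "(1 - ((real b - 1) / real b + (real b - 1) / real b ^ 2)) * moment b \<alpha> 0 = 1"
    by (simp add: left_diff_distrib)
  moreover have "1 - ((real b - 1) / real b + (real b - 1) / real b ^ 2) = 1 / real b ^ 2"
    using assms by (simp add: field_simps power2_eq_square)
  ultimately have "1 / real b ^ 2 * moment b \<alpha> 0 = 1"
    by (simp only:)
  then show ?thesis
    using assms by (simp add: divide_eq_eq)
qed

lemma moment_recurrence:
  assumes "b > 1" and "\<alpha> < b" and "m \<ge> 1"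
  shows "(real b ^ (m + 1) - (real b - 1) - (real b - 1) / real b ^ (m + 1)) * moment b \<alpha> m =
           (\<Sum>j = 1..m. real (m choose j) *
              (gamma' b \<alpha> j + theta' b \<alpha> j / real b ^ (m + 1)) * moment b \<alpha> (m - j))"
proof -
  define B where "B = real b ^ (m + 1)"
  let ?t = "\<lambda>j. real (m choose j) * (gamma' b \<alpha> j + theta' b \<alpha> j / B) * moment b \<alpha> (m - j)"
  have B: "B > 0" and BB: "real b ^ (2 * (m + 1)) = B * B"
    unfolding B_def using assms by (auto simp: power_add[symmetric] mult_2)
  have "moment b \<alpha> m = (\<Sum>j\<le>m. real (m choose j) * (gamma' b \<alpha> j / B + theta' b \<alpha> j / (B * B)) *
      moment b \<alpha> (m - j))"
    using moment_self_similar[OF assms(1,2), of m] assms(3) unfolding BB B_def[symmetric] by simp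
  also have "\<dots> = (\<Sum>j\<le>m. ?t j / B)"
    by (intro sum.cong refl) (simp add: add_divide_distrib distrib_left distrib_right)
  finally have "B * moment b \<alpha> m = (\<Sum>j\<le>m. ?t j)"
    using B by (simp add: sum_divide_distrib[symmetric])
  also have "\<dots> = ?t 0 + (\<Sum>j = 1..m. ?t j)"
    by (simp add: atMost_atLeast0 sum.atLeast_Suc_atMost)
  also have "?t 0 = (real b - 1) * moment b \<alpha> m + (real b - 1) / B * moment b \<alpha> m"
    using assms by (simp add: gamma'_0 theta'_0 distrib_right)
  finally show ?thesis
    unfolding B_def[symmetric] left_diff_distrib by linarith
qed

text \<open>
  The measure is not concentrated at zero, which makes the moments positive and strictly
  decreasing.
\<close>

lemma tails_positive_frac:
  assumes "b > 1" and "\<alpha> < b"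
  obtains w where "w \<in> tails b \<alpha>" "base_frac b w > 0"
proof (cases "\<alpha> = 0")
  case True
  show ?thesis
    by (rule that[of "[1]"]) (use True assms in \<open>auto simp: tails_def sublist_double_Cons\<close>)
next
  case False
  \<comment> \<open>The leading zero keeps the word in \<open>tails b \<alpha>\<close> even when \<open>\<alpha> = 1\<close>.\<close>
  show ?thesis
    by (rule that[of "[0, 1]"]) (use False assms in \<open>auto simp: tails_def sublist_double_Cons\<close>)
qed

lemma moment_pos:
  assumes "b > 1" and "\<alpha> < b"
  shows "moment b \<alpha> m > 0"
proof -
  obtain w where w: "w \<in> tails b \<alpha>" "base_frac b w > 0"
    using tails_positive_frac[OF assms] .
  show ?thesis
    by (rule has_sum_strict_mono[OF has_sum_0 moment_has_sum[OF assms] _ w(1)])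
       (use w assms base_frac_nonneg in auto)
qed

lemma moment_strict_decreasing:
  assumes "b > 1" and "\<alpha> < b"
  shows "moment b \<alpha> (Suc m) < moment b \<alpha> m"
proof -
  obtain w where w: "w \<in> tails b \<alpha>" "base_frac b w > 0"
    using tails_positive_frac[OF assms] .
  show ?thesis
  proof (rule has_sum_strict_mono[OF moment_has_sum[OF assms] moment_has_sum[OF assms] _ w(1)])
    show "weight b v * base_frac b v ^ Suc m \<le> weight b v * base_frac b v ^ m"
      if "v \<in> tails b \<alpha>" for v
      using tails_frac_less_1[OF that] base_frac_nonneg[of b v]
      by (intro mult_left_mono power_decreasing) auto
    show "weight b w * base_frac b w ^ Suc m < weight b w * base_frac b w ^ m"
      using tails_frac_less_1[OF w(1)] w(2) assms
      by (intro mult_strict_left_mono power_strict_decreasing) auto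
  qed
qed

text \<open>
  Dominated convergence: up to \<open>r / 2\<close> the mass sits on a finite set of words, and on that set the
  powers of \<open>base_frac b w < 1\<close> tend to zero.
\<close>

lemma moment_tendsto_0:
  assumes "b > 1" and "\<alpha> < b"
  shows "moment b \<alpha> \<longlonglongrightarrow> 0"
proof (rule LIMSEQ_I)
  fix r :: real assume "r > 0"
  let ?T = "tails b \<alpha>"
  let ?g = "\<lambda>m w. weight b w * base_frac b w ^ m"
  obtain F where F: "finite F" "F \<subseteq> ?T" and "dist (sum (weight b) F) (infsum (weight b) ?T) \<le> r / 2"
    using infsum_finite_approximation[OF weight_summable[OF assms], of "r / 2"] \<open>r > 0\<close> by auto
  then have rest: "infsum (weight b) ?T - sum (weight b) F \<le> r / 2"
    unfolding dist_real_def by linarith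
  have "(\<lambda>m. \<Sum>w\<in>F. ?g m w) \<longlonglongrightarrow> (\<Sum>w\<in>F. weight b w * 0)"
  proof (rule tendsto_sum)
    fix w assume "w \<in> F"
    then have "base_frac b w < 1"
      using F(2) tails_frac_less_1 by blast
    then show "(\<lambda>m. ?g m w) \<longlonglongrightarrow> weight b w * 0"
      by (rule tendsto_mult_left[OF LIMSEQ_realpow_zero[OF base_frac_nonneg]])
  qed
  then have "eventually (\<lambda>m. (\<Sum>w\<in>F. ?g m w) < r / 2) sequentially"
    using \<open>r > 0\<close> by (intro order_tendstoD(2)[where y = 0]) simp_all
  then obtain N where N: "(\<Sum>w\<in>F. ?g m w) < r / 2" if "m \<ge> N" for m
    by (auto simp: eventually_sequentially)
  have "norm (moment b \<alpha> m - 0) < r" if "m \<ge> N" for m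
  proof -
    have "moment b \<alpha> m - sum (?g m) F \<le> infsum (weight b) ?T - sum (weight b) F"
    proof (rule has_sum_mono)
      show "(?g m has_sum moment b \<alpha> m - sum (?g m) F) (?T - F)"
        by (intro has_sum_Diff moment_has_sum assms has_sum_finite F)
      show "(weight b has_sum infsum (weight b) ?T - sum (weight b) F) (?T - F)"
        by (intro has_sum_Diff has_sum_infsum weight_summable assms has_sum_finite F)
      show "?g m w \<le> weight b w" if "w \<in> ?T - F" for w
        using tails_frac_less_1[of w b \<alpha>] base_frac_nonneg[of b w] that
        by (intro mult_left_le power_le_one) auto
    qed
    then show ?thesis
      using rest N[OF that] moment_pos[OF assms, of m] by simp
  qed
  then show "\<exists>N. \<forall>m\<ge>N. norm (moment b \<alpha> m - 0) < r"
    by blast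
qed

section \<open>The sum over all continuations of one block\<close>

text \<open>
  For \<open>N > 0\<close> this is the sum of \<open>1 / n\<close> over the integers \<open>n\<close> whose numeral is that of \<open>N\<close>
  followed by a word of \<open>tails b \<alpha>\<close>.
\<close>

definition continuation_sum :: "nat \<Rightarrow> nat \<Rightarrow> nat \<Rightarrow> real" where
  "continuation_sum b \<alpha> N = (\<Sum>\<^sub>\<infinity>w\<in>tails b \<alpha>. weight b w / (real N + base_frac b w))"

lemma alternating_geometric_remainder:
  fixes x N :: real
  assumes "N > 0" and "x \<ge> 0"
  shows "1 / (N + x) - (\<Sum>m<M. (-1) ^ m * x ^ m / N ^ (m + 1)) = (-1) ^ M * x ^ M / (N ^ M * (N + x))"
proof (induction M)
  case (Suc M)
  have "N + x > 0" using assms by simp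
  then have "(-1) ^ M * x ^ M / (N ^ M * (N + x)) - (-1) ^ M * x ^ M / N ^ (M + 1) =
      (-1) ^ Suc M * x ^ Suc M / (N ^ Suc M * (N + x))"
    using assms(1) by (simp add: divide_simps) (simp add: algebra_simps)
  then show ?case
    using Suc.IH by (simp only: sum.lessThan_Suc)
qed simp

lemma continuation_sum_has_sum:
  assumes "b > 1" and "\<alpha> < b" and "N > 0"
  shows "((\<lambda>w. weight b w / (real N + base_frac b w)) has_sum continuation_sum b \<alpha> N) (tails b \<alpha>)"
proof -
  have "(\<lambda>w. weight b w / (real N + base_frac b w)) summable_on tails b \<alpha>"
  proof (rule summable_on_comparison_test[OF weight_summable[OF assms(1,2)]])
    fix w
    have "real N + base_frac b w \<ge> 1"
      using assms(3) base_frac_nonneg[of b w] by linarith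
    then have "weight b w / (real N + base_frac b w) \<le> weight b w / 1"
      by (intro divide_left_mono) auto
    then show "weight b w / (real N + base_frac b w) \<le> weight b w"
      by simp
    show "0 \<le> weight b w / (real N + base_frac b w)"
      using base_frac_nonneg[of b w] by simp
  qed
  then show ?thesis
    unfolding continuation_sum_def by (rule has_sum_infsum)
qed

text \<open>
  The remainder of the alternating geometric expansion is dominated pointwise by
  \<open>base_frac b w ^ M\<close> because \<open>N \<ge> 1\<close>, hence after summation by a moment that tends to zero.
\<close>

lemma continuation_sum_sums:
  assumes "b > 1" and "\<alpha> < b" and "N > 0"
  shows "(\<lambda>m. (-1) ^ m * moment b \<alpha> m * (1 / real N ^ (m + 1))) sums continuation_sum b \<alpha> N"
proof -
  let ?T = "tails b \<alpha>" and ?x = "base_frac b"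
  let ?part = "\<lambda>M. \<Sum>m<M. (-1) ^ m * moment b \<alpha> m * (1 / real N ^ (m + 1))"
  have bound: "\<bar>continuation_sum b \<alpha> N - ?part M\<bar> \<le> moment b \<alpha> M" for M
  proof -
    define h where "h w = weight b w / (real N + ?x w) +
        - (\<Sum>m<M. (-1) ^ m * (1 / real N ^ (m + 1)) * (weight b w * ?x w ^ m))" for w
    have "(h has_sum (continuation_sum b \<alpha> N +
        - (\<Sum>m<M. (-1) ^ m * (1 / real N ^ (m + 1)) * moment b \<alpha> m))) ?T"
      unfolding h_def
      by (intro has_sum_add has_sum_uminusI continuation_sum_has_sum has_sum_sum has_sum_cmult_right
            moment_has_sum assms) simp
    then have h: "(h has_sum (continuation_sum b \<alpha> N - ?part M)) ?T"
      by (simp add: mult_ac)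
    have hw: "\<bar>h w\<bar> \<le> weight b w * ?x w ^ M" for w
    proof -
      have "h w = weight b w * (1 / (real N + ?x w) - (\<Sum>m<M. (-1) ^ m * ?x w ^ m / real N ^ (m + 1)))"
        by (simp add: h_def right_diff_distrib sum_distrib_left mult_ac)
      also have "\<dots> = weight b w * ((-1) ^ M * ?x w ^ M / (real N ^ M * (real N + ?x w)))"
        using assms(3) base_frac_nonneg by (subst alternating_geometric_remainder) auto
      finally have "\<bar>h w\<bar> = weight b w * ?x w ^ M / (real N ^ M * (real N + ?x w))"
        using base_frac_nonneg[of b w] by (simp add: abs_mult power_abs)
      also have "\<dots> \<le> weight b w * ?x w ^ M / 1"
      proof (rule divide_left_mono)
        have "1 * 1 \<le> real N ^ M * (real N + ?x w)"
          using assms(3) base_frac_nonneg[of b w] by (intro mult_mono one_le_power) auto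
        then show "1 \<le> real N ^ M * (real N + ?x w)"
          by simp
        then show "0 < real N ^ M * (real N + ?x w) * 1"
          by linarith
      qed (use base_frac_nonneg[of b w] in simp)
      finally show ?thesis
        by simp
    qed
    have "continuation_sum b \<alpha> N - ?part M \<le> moment b \<alpha> M"
      by (rule has_sum_mono[OF h moment_has_sum[OF assms(1,2)]]) (use hw abs_le_D1 in blast)
    moreover have "- (continuation_sum b \<alpha> N - ?part M) \<le> moment b \<alpha> M"
      by (rule has_sum_mono[OF has_sum_uminusI[OF h] moment_has_sum[OF assms(1,2)]])
         (use hw abs_le_D2 in blast)
    ultimately show ?thesis by linarith
  qed
  have "(\<lambda>M. continuation_sum b \<alpha> N - ?part M) \<longlonglongrightarrow> 0"
    by (rule Lim_null_comparison[OF _ moment_tendsto_0[OF assms(1,2)]]) (use bound in auto)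
  then have "(\<lambda>M. continuation_sum b \<alpha> N - (continuation_sum b \<alpha> N - ?part M))
      \<longlonglongrightarrow> continuation_sum b \<alpha> N - 0"
    by (intro tendsto_intros)
  then show ?thesis
    by (simp add: sums_def)
qed

section \<open>Integers without a double digit\<close>

abbreviation admissible_numerals :: "nat \<Rightarrow> nat \<Rightarrow> nat list set" where
  "admissible_numerals b \<alpha> \<equiv>
     {ds. ds \<noteq> [] \<and> hd ds \<noteq> 0 \<and> set ds \<subseteq> {..<b} \<and> \<not> sublist [\<alpha>, \<alpha>] ds}"

lemma has_sum_no_double_iff:
  assumes "b > 1"
  shows "((\<lambda>n. 1 / real n) has_sum S) (no_double b \<alpha>) \<longleftrightarrow>
    ((\<lambda>ds. 1 / (real b ^ length ds * base_frac b ds)) has_sum S) (admissible_numerals b \<alpha>)"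
proof (rule has_sum_reindex_bij_witness[where j = "base_digits b"
      and i = "\<lambda>ds. horner_sum (\<lambda>d. d) b (rev ds)"])
  fix n assume n: "n \<in> no_double b \<alpha>"
  define ds where "ds = base_digits b n"
  have ds: "\<forall>d\<in>set ds. d < b" "ds \<noteq> [] \<longrightarrow> hd ds \<noteq> 0" and val: "horner_sum (\<lambda>d. d) b (rev ds) = n"
    using base_digits_unique[OF assms, of ds n] ds_def by blast+
  then have "ds \<noteq> []"
    using n by (auto simp: no_double_def)
  then show "base_digits b n \<in> admissible_numerals b \<alpha>"
    using n ds by (auto simp: no_double_def ds_def)
  show "horner_sum (\<lambda>d. d) b (rev (base_digits b n)) = n"
    using val ds_def by simp
  then have "real n = real b ^ length (base_digits b n) * base_frac b (base_digits b n)"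
    using digits_value_eq_frac[of b "base_digits b n"] assms by simp
  then show "1 / (real b ^ length (base_digits b n) * base_frac b (base_digits b n)) = 1 / real n"
    by simp
next
  fix ds assume ds: "ds \<in> admissible_numerals b \<alpha>"
  then show dig: "base_digits b (horner_sum (\<lambda>d. d) b (rev ds)) = ds"
    using base_digits_unique[OF assms, of ds "horner_sum (\<lambda>d. d) b (rev ds)"] by auto
  have "horner_sum (\<lambda>d. d) b (rev ds) \<noteq> 0"
    using dig ds by (metis (mono_tags, lifting) base_digits_0 mem_Collect_eq)
  then show "horner_sum (\<lambda>d. d) b (rev ds) \<in> no_double b \<alpha>"
    using ds dig by (simp add: no_double_def)
qed auto

abbreviation pair_blocks :: "nat \<Rightarrow> nat \<Rightarrow> (nat \<times> nat) set" where
  "pair_blocks b \<alpha> \<equiv> {(n1, n2). 1 \<le> n1 \<and> n1 < b \<and> n2 < b \<and> (n1, n2) \<noteq> (\<alpha>, \<alpha>)}"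

abbreviation triple_blocks :: "nat \<Rightarrow> nat \<Rightarrow> (nat \<times> nat) set" where
  "triple_blocks b \<alpha> \<equiv> {(n1, n2). 1 \<le> n1 \<and> n1 < b \<and> n2 < b \<and> n2 \<noteq> \<alpha>}"

lemma finite_blocks: "finite (pair_blocks b \<alpha>)" "finite (triple_blocks b \<alpha>)"
  by (rule finite_subset[of _ "{..<b} \<times> {..<b}"]; auto)+

text \<open>
  A numeral \<open>n1 # n2 # v\<close> belongs to the first family if \<open>v\<close> is in \<open>tails b \<alpha>\<close>, and otherwise,
  \<open>v\<close> beginning with \<open>\<alpha>\<close>, to the second, where that \<open>\<alpha>\<close> is absorbed into the block.
\<close>

lemma admissible_numerals_unfold:
  assumes "\<alpha> < b"
  shows "admissible_numerals b \<alpha> = (\<lambda>d. [d]) ` {1..b - 1} \<union>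
    ((\<Union>i\<in>pair_blocks b \<alpha>. (@) [fst i, snd i] ` tails b \<alpha>) \<union>
     (\<Union>i\<in>triple_blocks b \<alpha>. (@) [fst i, snd i, \<alpha>] ` tails b \<alpha>))" (is "_ = ?one \<union> (?two \<union> ?three)")
proof (rule set_eqI)
  fix ds :: "nat list"
  consider (nil) "ds = []" | (one) d where "ds = [d]" | (more) n1 n2 w where "ds = n1 # n2 # w"
    by (metis list.exhaust)
  then show "ds \<in> admissible_numerals b \<alpha> \<longleftrightarrow> ds \<in> ?one \<union> (?two \<union> ?three)"
  proof cases
    case more
    have "ds \<in> ?two \<union> ?three \<longleftrightarrow> (n1, n2) \<in> pair_blocks b \<alpha> \<and> w \<in> tails b \<alpha> \<or>
        (n1, n2) \<in> triple_blocks b \<alpha> \<and> w \<in> (#) \<alpha> ` tails b \<alpha>"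
      unfolding more by (auto simp: image_iff)
    also have "\<dots> \<longleftrightarrow> 1 \<le> n1 \<and> n1 < b \<and> n2 < b \<and> (n1, n2) \<noteq> (\<alpha>, \<alpha>) \<and>
        w \<in> tails b \<alpha> \<union> (#) \<alpha> ` tails b \<alpha> \<and> (w \<noteq> [] \<and> hd w = \<alpha> \<longrightarrow> n2 \<noteq> \<alpha>)"
      by (auto simp: tails_def)
    also have "\<dots> \<longleftrightarrow> ds \<in> admissible_numerals b \<alpha>"
      unfolding no_double_split[OF assms, symmetric] more by (auto simp: sublist_double_Cons)
    finally have "ds \<in> admissible_numerals b \<alpha> \<longleftrightarrow> ds \<in> ?two \<union> ?three" ..
    moreover have "ds \<notin> ?one"
      using more by auto
    ultimately show ?thesis by (simp only: Un_iff simp_thms)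
  qed (auto simp: sublist_double_Cons)
qed

lemma no_double_has_sum:
  assumes "b > 1" and "\<alpha> < b"
  shows "((\<lambda>n. 1 / real n) has_sum ((\<Sum>d = 1..b - 1. 1 / real d) +
    ((\<Sum>(n1, n2)\<in>pair_blocks b \<alpha>. continuation_sum b \<alpha> (n1 * b + n2)) +
     (\<Sum>(n1, n2)\<in>triple_blocks b \<alpha>. continuation_sum b \<alpha> (n1 * b\<^sup>2 + n2 * b + \<alpha>))))) (no_double b \<alpha>)"
proof -
  let ?g = "\<lambda>ds. 1 / (real b ^ length ds * base_frac b ds)"
  let ?T = "tails b \<alpha>"
  let ?one = "(\<lambda>d. [d]) ` {1..b - 1}"
  let ?two = "\<Union>i\<in>pair_blocks b \<alpha>. (@) [fst i, snd i] ` ?T"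
  let ?three = "\<Union>i\<in>triple_blocks b \<alpha>. (@) [fst i, snd i, \<alpha>] ` ?T"
  have b: "real b > 0"
    using assms by simp
  have one: "(?g has_sum (\<Sum>d = 1..b - 1. 1 / real d)) ?one"
    using b by (intro has_sum_finiteI) (auto simp: sum.reindex inj_on_def)
  have two: "(?g has_sum (\<Sum>i\<in>pair_blocks b \<alpha>. continuation_sum b \<alpha> (fst i * b + snd i))) ?two"
  proof (rule has_sum_prefixed[where k = 2])
    fix i assume "i \<in> pair_blocks b \<alpha>"
    then have "fst i * b + snd i > 0"
      using assms by auto
    moreover have "?g ([fst i, snd i] @ w) =
        weight b w / (real (fst i * b + snd i) + base_frac b w)" for w
    proof -
      have "real b ^ length ([fst i, snd i] @ w) * base_frac b ([fst i, snd i] @ w) =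
          real b ^ length w * (real (fst i * b + snd i) + base_frac b w)"
        using b by (simp add: field_simps)
      then show ?thesis by (simp only:) simp
    qed
    ultimately show "((\<lambda>w. ?g ([fst i, snd i] @ w)) has_sum
        continuation_sum b \<alpha> (fst i * b + snd i)) ?T"
      by (simp only: continuation_sum_has_sum[OF assms])
  qed (rule finite_blocks, auto simp: inj_on_def)
  have three: "(?g has_sum (\<Sum>i\<in>triple_blocks b \<alpha>.
      continuation_sum b \<alpha> (fst i * b\<^sup>2 + snd i * b + \<alpha>))) ?three"
  proof (rule has_sum_prefixed[where k = 3])
    fix i assume "i \<in> triple_blocks b \<alpha>"
    then have "fst i * b\<^sup>2 + snd i * b + \<alpha> > 0"
      using assms by auto
    moreover have "?g ([fst i, snd i, \<alpha>] @ w) =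
        weight b w / (real (fst i * b\<^sup>2 + snd i * b + \<alpha>) + base_frac b w)" for w
    proof -
      have "real b ^ length ([fst i, snd i, \<alpha>] @ w) * base_frac b ([fst i, snd i, \<alpha>] @ w) =
          real b ^ length w * (real (fst i * b\<^sup>2 + snd i * b + \<alpha>) + base_frac b w)"
        using b by (simp add: field_simps power2_eq_square)
      then show ?thesis by (simp only:) simp
    qed
    ultimately show "((\<lambda>w. ?g ([fst i, snd i, \<alpha>] @ w)) has_sum
        continuation_sum b \<alpha> (fst i * b\<^sup>2 + snd i * b + \<alpha>)) ?T"
      by (simp only: continuation_sum_has_sum[OF assms])
  qed (rule finite_blocks, auto simp: inj_on_def)
  have "?two \<inter> ?three = {}"
    by (auto simp: tails_def)
  moreover have "?one \<inter> (?two \<union> ?three) = {}"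
    by auto
  ultimately have "(?g has_sum ((\<Sum>d = 1..b - 1. 1 / real d) +
      ((\<Sum>i\<in>pair_blocks b \<alpha>. continuation_sum b \<alpha> (fst i * b + snd i)) +
       (\<Sum>i\<in>triple_blocks b \<alpha>. continuation_sum b \<alpha> (fst i * b\<^sup>2 + snd i * b + \<alpha>)))))
      (?one \<union> (?two \<union> ?three))"
    by (intro has_sum_Un_disjoint one two three)
  then show ?thesis
    unfolding has_sum_no_double_iff[OF assms(1)] admissible_numerals_unfold[OF assms(2)]
    by (simp only: case_prod_unfold)
qed

lemma block_series_sums:
  assumes "b > 1" and "\<alpha> < b"
  shows "(\<lambda>m. (-1) ^ m * moment b \<alpha> m * block_sum b \<alpha> (m + 1)) sums
    ((\<Sum>(n1, n2)\<in>pair_blocks b \<alpha>. continuation_sum b \<alpha> (n1 * b + n2)) +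
     (\<Sum>(n1, n2)\<in>triple_blocks b \<alpha>. continuation_sum b \<alpha> (n1 * b\<^sup>2 + n2 * b + \<alpha>)))"
proof -
  have "(\<lambda>m. (\<Sum>i\<in>pair_blocks b \<alpha>.
            (-1) ^ m * moment b \<alpha> m * (1 / real (fst i * b + snd i) ^ (m + 1))) +
          (\<Sum>i\<in>triple_blocks b \<alpha>.
            (-1) ^ m * moment b \<alpha> m * (1 / real (fst i * b\<^sup>2 + snd i * b + \<alpha>) ^ (m + 1)))) sums
        ((\<Sum>i\<in>pair_blocks b \<alpha>. continuation_sum b \<alpha> (fst i * b + snd i)) +
         (\<Sum>i\<in>triple_blocks b \<alpha>. continuation_sum b \<alpha> (fst i * b\<^sup>2 + snd i * b + \<alpha>)))"
    by (intro sums_add sums_sum continuation_sum_sums assms) (use assms in auto)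
  then show ?thesis
    by (simp only: block_sum_def case_prod_unfold distrib_left sum_distrib_left)
qed

theorem theorem16:
  fixes b \<alpha> :: nat
  assumes "b > 1" and "\<alpha> < b"
  shows "(\<lambda>n. 1 / real n) summable_on no_double b \<alpha> \<and>
    (\<exists>u :: nat \<Rightarrow> real.
       (\<forall>m. u m > 0) \<and>
       (\<forall>m. u (Suc m) < u m) \<and>
       u \<longlonglongrightarrow> 0 \<and>
       u 0 = real b ^ 2 \<and>
       (\<forall>m\<ge>1. (real b ^ (m + 1) - (real b - 1) - (real b - 1) / real b ^ (m + 1)) * u m =
          (\<Sum>j = 1..m. real (m choose j) *
             (gamma' b \<alpha> j + theta' b \<alpha> j / real b ^ (m + 1)) * u (m - j))) \<and>
       summable (\<lambda>m. (- 1) ^ Suc m * u (Suc m) * block_sum b \<alpha> (Suc m + 1)) \<and>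
       K0 b \<alpha> = (\<Sum>n1 = 1..b - 1. 1 / real n1) + real b ^ 2 * block_sum b \<alpha> 1 +
         (\<Sum>m. (- 1) ^ Suc m * u (Suc m) * block_sum b \<alpha> (Suc m + 1)))"
proof -
  let ?u = "moment b \<alpha>"
  let ?C = "(\<Sum>(n1, n2)\<in>pair_blocks b \<alpha>. continuation_sum b \<alpha> (n1 * b + n2)) +
     (\<Sum>(n1, n2)\<in>triple_blocks b \<alpha>. continuation_sum b \<alpha> (n1 * b\<^sup>2 + n2 * b + \<alpha>))"
  have K0: "K0 b \<alpha> = (\<Sum>n1 = 1..b - 1. 1 / real n1) + ?C"
    unfolding K0_def using no_double_has_sum[OF assms] by (rule infsumI)
  have series: "(\<lambda>m. (- 1) ^ Suc m * ?u (Suc m) * block_sum b \<alpha> (Suc m + 1)) sums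
      (?C - real b ^ 2 * block_sum b \<alpha> 1)"
    using block_series_sums[OF assms] moment_0[OF assms]
    by (subst sums_Suc_iff) simp
  show ?thesis
  proof (intro conjI exI[of _ ?u] allI impI)
    show "(\<lambda>n. 1 / real n) summable_on no_double b \<alpha>"
      using no_double_has_sum[OF assms] by (rule has_sum_imp_summable)
    show "summable (\<lambda>m. (- 1) ^ Suc m * ?u (Suc m) * block_sum b \<alpha> (Suc m + 1))"
      using series by (rule sums_summable)
    show "K0 b \<alpha> = (\<Sum>n1 = 1..b - 1. 1 / real n1) + real b ^ 2 * block_sum b \<alpha> 1 +
         (\<Sum>m. (- 1) ^ Suc m * ?u (Suc m) * block_sum b \<alpha> (Suc m + 1))"
      using K0 sums_unique[OF series] by linarith
  qed (fact moment_pos[OF assms] moment_strict_decreasing[OF assms] moment_tendsto_0[OF assms]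
      moment_0[OF assms] moment_recurrence[OF assms])+
qed

end
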